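(* Let $M=(V,\rho)$ be a metric space with $|V| = n \geq 2$ and let $W = \{\rho(a,b) : a,b \in V,\ a \neq b\}$. Then $M$ has at least $\frac{n}{5|W|}$ distinct lines.
   Context: For distinct points $a,b,c$ write $[abc]$ if $\rho(a,c) = \rho(a,b)+\rho(b,c)$; $\{a,b,c\}$ is collinear if one of $[abc],[bca],[cab]$ holds. For distinct $a,b$, the line $\overline{ab}$ is $\{a,b\}$ together with all $c$ such that $\{a,b,c\}$ is collinear. *)

theory Defs
  imports "HOL-Analysis.Analysis"
begin

text \<open>The name \<open>mbetween\<close> avoids a clash with the library's Euclidean \<^const>\<open>between\<close>;
  similarly for \<open>mcollinear\<close>. The argument order follows the notation \<open>[abc]\<close>: the middle
  argument is the point in between. Distinctness of the three points is part of the predicate.\<close>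

definition mbetween :: "('a \<Rightarrow> 'a \<Rightarrow> real) \<Rightarrow> 'a \<Rightarrow> 'a \<Rightarrow> 'a \<Rightarrow> bool" where
  "mbetween \<rho> a b c \<longleftrightarrow> a \<noteq> b \<and> b \<noteq> c \<and> a \<noteq> c \<and> \<rho> a c = \<rho> a b + \<rho> b c"

definition mcollinear :: "('a \<Rightarrow> 'a \<Rightarrow> real) \<Rightarrow> 'a \<Rightarrow> 'a \<Rightarrow> 'a \<Rightarrow> bool" where
  "mcollinear \<rho> a b c \<longleftrightarrow> mbetween \<rho> a b c \<or> mbetween \<rho> b c a \<or> mbetween \<rho> c a b"

definition mline :: "'a set \<Rightarrow> ('a \<Rightarrow> 'a \<Rightarrow> real) \<Rightarrow> 'a \<Rightarrow> 'a \<Rightarrow> 'a set" where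
  "mline V \<rho> a b = {a, b} \<union> {c \<in> V. mcollinear \<rho> a b c}"

text \<open>Lines are compared as point sets, so pairs generating the same set count once.\<close>

definition mlines :: "'a set \<Rightarrow> ('a \<Rightarrow> 'a \<Rightarrow> real) \<Rightarrow> 'a set set" where
  "mlines V \<rho> = {mline V \<rho> a b | a b. a \<in> V \<and> b \<in> V \<and> a \<noteq> b}"

end

theory Submission
  imports Defs
begin

text \<open>Let \<open>m\<close> be the number of lines and \<open>w\<close> the number of distances. If \<open>\<rho> x y = \<rho> x z\<close> and
  \<open>line x y = line x z\<close> with \<open>y \<noteq> z\<close>, then \<open>\<rho> y z = 2 * \<rho> x y\<close>. Let \<open>r\<close> be the largest
  radius at which this happens, and \<open>v\<close> one of the two points \<open>y\<close>, \<open>z\<close>. Since a point \<open>t\<close> at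
  distance more than \<open>r\<close> from \<open>a\<close> is determined by \<open>\<rho> a t\<close> and \<open>line a t\<close>, all but
  \<open>2 * (w - 1) * m\<close> points lie on the sphere \<open>S\<close> of radius \<open>r\<close> around \<open>v\<close>. Partition \<open>S\<close> into
  classes by the line through \<open>v\<close>; distinct points of a class are at distance \<open>2 * r\<close>, and the
  classes with at most two points cover at most \<open>2 * m\<close> points. If a remaining point \<open>c\<close> is closer
  than \<open>r\<close> to \<open>a\<close>, then it is at medium distance (strictly between \<open>r\<close> and \<open>2 * r\<close>) from the rest
  of the class of \<open>a\<close>; counting medium pairs by line and distance, at most \<open>2 * (w - 2) * m\<close> points
  have such an \<open>a\<close>. Among the others, each line comes from at most one medium pair, while every
  coincidence between lines spanned by disjoint pairs inside classes produces a medium pair, so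
  there are at most \<open>6 * m\<close> of them. The total is at most \<open>(4 * w + 2) * m \<le> 5 * w * m\<close>, since
  \<open>w \<ge> 2\<close>.\<close>

section \<open>Counting in the fibres of a map\<close>

text \<open>Greedy removal: while a fibre contains three points \<open>a\<close>, \<open>b\<close>,
  \<open>c\<close>, take out the pair \<open>a\<close>, \<open>b\<close> and record \<open>c\<close>
  as the third point \<open>u a\<close>. Since \<open>c\<close> stays, the image of \<open>f\<close>
  does not shrink; at the end every fibre has at most two points.\<close>

lemma ex_disjoint_pairs_in_fibres:
  assumes "finite Y"
  shows "\<exists>D g u. D \<subseteq> Y \<and> g ` D \<subseteq> Y \<and> inj_on g D \<and> D \<inter> g ` D = {} \<and>
    (\<forall>y\<in>D. f (g y) = f y \<and> u y \<in> Y \<and> f (u y) = f y \<and> u y \<noteq> y \<and> u y \<noteq> g y) \<and>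
    card Y \<le> 2 * card D + 2 * card (f ` Y)"
  using assms
proof (induction "card Y" arbitrary: Y rule: less_induct)
  case less
  show ?case
  proof (cases "\<exists>a b c. a \<in> Y \<and> b \<in> Y \<and> c \<in> Y \<and> a \<noteq> b \<and> a \<noteq> c \<and> b \<noteq> c \<and> f a = f b \<and> f b = f c")
    case True
    then obtain a b c where abc: "a \<in> Y" "b \<in> Y" "c \<in> Y" "a \<noteq> b" "a \<noteq> c" "b \<noteq> c"
      "f a = f b" "f b = f c" by blast
    define Z where "Z = Y - {a, b}"
    have cZ: "card Y = card Z + 2"
      using less.prems abc card_Diff_subset[of "{a,b}" Y] card_mono[of Y "{a,b}"]
      by (simp add: Z_def)
    have fZ: "f ` Z = f ` Y"
    proof
      show "f ` Y \<subseteq> f ` Z"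
      proof
        fix t assume "t \<in> f ` Y"
        then obtain z where z: "z \<in> Y" "t = f z" by blast
        show "t \<in> f ` Z"
        proof (cases "z \<in> {a,b}")
          case True
          then have "t = f c" using z abc by auto
          then show ?thesis using abc Z_def by blast
        qed (use z Z_def in blast)
      qed
    qed (auto simp: Z_def)
    have "finite Z" using less.prems Z_def by simp
    from less.hyps[OF _ this] cZ obtain D g u where
      D: "D \<subseteq> Z" "g ` D \<subseteq> Z" "inj_on g D" "D \<inter> g ` D = {}"
        "\<forall>y\<in>D. f (g y) = f y \<and> u y \<in> Z \<and> f (u y) = f y \<and> u y \<noteq> y \<and> u y \<noteq> g y"
        "card Z \<le> 2 * card D + 2 * card (f ` Z)"
      by auto
    have aD: "a \<notin> D" "b \<notin> D" "a \<notin> g ` D" "b \<notin> g ` D" using D(1,2) Z_def by auto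
    have img: "g(a := b) ` insert a D = insert b (g ` D)" using aD by auto
    have finD: "finite D" using D(1) \<open>finite Z\<close> finite_subset by blast
    show ?thesis
    proof (rule exI[of _ "insert a D"], rule exI[of _ "g(a := b)"], rule exI[of _ "u(a := c)"],
        intro conjI)
      show "insert a D \<subseteq> Y" "g(a := b) ` insert a D \<subseteq> Y"
        unfolding img using D abc Z_def by auto
      show "inj_on (g(a := b)) (insert a D)"
        using D(3) aD by (auto simp: inj_on_def)
      show "insert a D \<inter> g(a := b) ` insert a D = {}"
        unfolding img using D(4) aD abc by auto
      show "\<forall>y\<in>insert a D. f ((g(a := b)) y) = f y \<and> (u(a := c)) y \<in> Y \<and>
          f ((u(a := c)) y) = f y \<and> (u(a := c)) y \<noteq> y \<and> (u(a := c)) y \<noteq> (g(a := b)) y"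
        using D(5) abc aD Z_def by auto
      show "card Y \<le> 2 * card (insert a D) + 2 * card (f ` Y)"
        using D(6) cZ fZ aD finD by simp
    qed
  next
    case False
    have "card Y = (\<Sum>t\<in>f ` Y. card {y \<in> Y. f y = t})"
      using sum.image_gen[OF less.prems, of "\<lambda>_. 1::nat" f] by simp
    also have "\<dots> \<le> (\<Sum>t\<in>f ` Y. 2)"
    proof (rule sum_mono, rule ccontr)
      fix t assume "t \<in> f ` Y" "\<not> card {y \<in> Y. f y = t} \<le> 2"
      then obtain A where "A \<subseteq> {y \<in> Y. f y = t}" "card A = 3"
        by (metis obtain_subset_with_card_n not_less_eq_eq numeral_2_eq_2 numeral_3_eq_3)
      then obtain a b c where "a \<in> Y" "b \<in> Y" "c \<in> Y" "a \<noteq> b" "a \<noteq> c" "b \<noteq> c"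
        "f a = t" "f b = t" "f c = t" by (auto simp: card_3_iff)
      then show False using False by metis
    qed
    finally have "card Y \<le> 2 * card (f ` Y)" by simp
    then show ?thesis by (intro exI[of _ "{}"]) simp
  qed
qed

lemma card_le_mult_image_fibres:
  assumes "finite A" "g ` A \<subseteq> B" "finite B" "\<And>b. b \<in> B \<Longrightarrow> card {a \<in> A. g a = b} \<le> k"
  shows "card A \<le> k * card B"
proof -
  have "card A = (\<Sum>t\<in>g ` A. card {y \<in> A. g y = t})"
    using sum.image_gen[OF assms(1), of "\<lambda>_. 1::nat" g] by simp
  also have "\<dots> \<le> (\<Sum>t\<in>g ` A. k)"
    using assms(2,4) by (intro sum_mono) blast
  also have "\<dots> \<le> k * card B"
    using card_mono[OF assms(3,2)] by simp
  finally show ?thesis .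
qed

text \<open>Fix one representative per fibre of \<open>h\<close>. Every other element coincides with
  its representative, which gives two ordered pairs.\<close>

lemma card_coincidences_ge:
  assumes "finite D" "h ` D \<subseteq> L" "finite L"
  shows "2 * card D \<le> 2 * card L + card {(y, s). y \<in> D \<and> s \<in> D \<and> y \<noteq> s \<and> h y = h s}"
proof -
  define p where "p = inv_into D h"
  define R where "R = p ` h ` D"
  have p: "p (h s) \<in> D" "h (p (h s)) = h s" if "s \<in> D" for s
    using that by (auto simp: p_def inv_into_into f_inv_into_f)
  have R: "R \<subseteq> D" using p R_def by auto
  have "card R \<le> card L"
    unfolding R_def
    by (meson assms card_image_le card_mono finite_imageI order_trans)
  moreover have "card D = card (D - R) + card R"
    using R assms(1) by (metis card_Diff_subset card_mono finite_subset le_add_diff_inverse2)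
  moreover
  let ?C = "{(y, s). y \<in> D \<and> s \<in> D \<and> y \<noteq> s \<and> h y = h s}"
  have ps: "p (h s) \<in> R" "s \<noteq> p (h s)" if "s \<in> D - R" for s
    using that unfolding R_def by force+
  let ?A = "(\<lambda>s. (s, p (h s))) ` (D - R)" and ?B = "(\<lambda>s. (p (h s), s)) ` (D - R)"
  have finC: "finite ?C"
    by (rule finite_subset[of _ "D \<times> D"]) (use assms(1) in auto)
  have "card (?A \<union> ?B) \<le> card ?C"
  proof (rule card_mono[OF finC])
    have "(s, p (h s)) \<in> ?C \<and> (p (h s), s) \<in> ?C" if "s \<in> D - R" for s
      using ps[OF that] p[of s] that by auto
    then show "?A \<union> ?B \<subseteq> ?C" by blast
  qed
  moreover have "card (?A \<union> ?B) = card ?A + card ?B"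
    using assms(1) ps by (intro card_Un_disjoint) auto
  moreover have "card ?A = card (D - R)" "card ?B = card (D - R)"
    by (intro card_image inj_onI; simp)+
  ultimately show ?thesis by linarith
qed

section \<open>Lines and distances in a finite metric space\<close>

locale finite_metric = Metric_space V \<rho> for V :: "'a set" and \<rho> :: "'a \<Rightarrow> 'a \<Rightarrow> real" +
  assumes finite_V: "finite V"
begin

abbreviation line :: "'a \<Rightarrow> 'a \<Rightarrow> 'a set" where "line \<equiv> mline V \<rho>"
abbreviation lines :: "'a set set" where "lines \<equiv> mlines V \<rho>"

definition dists :: "real set" where
  "dists = {\<rho> a b | a b. a \<in> V \<and> b \<in> V \<and> a \<noteq> b}"

lemma dist_pos: "a \<in> V \<Longrightarrow> b \<in> V \<Longrightarrow> a \<noteq> b \<Longrightarrow> 0 < \<rho> a b"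
  using nonneg[of a b] zero[of a b] by linarith

lemma mem_line_iff:
  assumes "a \<in> V" "b \<in> V" "c \<in> V" "a \<noteq> b" "c \<noteq> a" "c \<noteq> b"
  shows "c \<in> line a b \<longleftrightarrow>
    \<rho> c a = \<rho> a b + \<rho> c b \<or> \<rho> a b = \<rho> c a + \<rho> c b \<or> \<rho> c b = \<rho> a b + \<rho> c a"
  using assms by (auto simp: mline_def mcollinear_def mbetween_def commute)

lemma line_sym: "line a b = line b a"
  by (auto simp: mline_def mcollinear_def mbetween_def commute)

lemma ends_in_line: "a \<in> line a b" "b \<in> line a b"
  by (auto simp: mline_def)

lemma line_in_lines: "a \<in> V \<Longrightarrow> b \<in> V \<Longrightarrow> a \<noteq> b \<Longrightarrow> line a b \<in> lines"
  by (auto simp: mlines_def)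

lemma dist_in_dists: "a \<in> V \<Longrightarrow> b \<in> V \<Longrightarrow> a \<noteq> b \<Longrightarrow> \<rho> a b \<in> dists"
  by (auto simp: dists_def)

lemma finite_lines: "finite lines"
proof (rule finite_subset)
  show "lines \<subseteq> (\<lambda>(a, b). line a b) ` (V \<times> V)" by (auto simp: mlines_def)
qed (use finite_V in auto)

lemma finite_dists: "finite dists"
proof (rule finite_subset)
  show "dists \<subseteq> (\<lambda>(a, b). \<rho> a b) ` (V \<times> V)" by (auto simp: dists_def)
qed (use finite_V in auto)

text \<open>With \<open>y\<close> or \<open>z\<close> in the middle, the equal distances from
  \<open>x\<close> would force \<rho> y z = 0, so \<open>x\<close> is the middle point.\<close>

lemma antipodal_if_same_line:
  assumes "x \<in> V" "y \<in> V" "z \<in> V" "x \<noteq> y" "x \<noteq> z" "y \<noteq> z"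
    and "\<rho> x y = \<rho> x z" "line x y = line x z"
  shows "\<rho> y z = 2 * \<rho> x y"
proof -
  have "z \<in> line x y" using assms(8) ends_in_line by simp
  then show ?thesis
    using mem_line_iff[of x y z] assms dist_pos[of y z] commute[of z x] commute[of z y] by auto
qed

end

text \<open>In the application, \<open>r\<close> is the largest \<open>\<rho> x v = \<rho> x v'\<close> with \<open>v \<noteq> v'\<close> and
  \<open>line x v = line x v'\<close>, so that \<open>\<rho> v v' = 2 * r\<close>.\<close>

locale extremal_radius = finite_metric +
  fixes r :: real and v :: 'a
  assumes v_in_V: "v \<in> V" and r_pos: "0 < r"
    and companion_unique: "\<lbrakk>x \<in> V; y \<in> V; z \<in> V; x \<noteq> y; x \<noteq> z; \<rho> x y = \<rho> x z; r < \<rho> x y;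
      line x y = line x z\<rbrakk> \<Longrightarrow> y = z"
begin

lemma card_far_le:
  assumes "a \<in> V"
  shows "card {t \<in> V. r < \<rho> a t} \<le> card {d \<in> dists. r < d} * card lines"
proof -
  have ne: "t \<noteq> a" if "r < \<rho> a t" for t
    using that r_pos zero[OF assms assms] by auto
  have "card {t \<in> V. r < \<rho> a t} \<le> card ({d \<in> dists. r < d} \<times> lines)"
  proof (rule card_inj_on_le)
    show "inj_on (\<lambda>t. (\<rho> a t, line a t)) {t \<in> V. r < \<rho> a t}"
      using companion_unique[OF assms] ne by (auto simp: inj_on_def)
    show "(\<lambda>t. (\<rho> a t, line a t)) ` {t \<in> V. r < \<rho> a t} \<subseteq> {d \<in> dists. r < d} \<times> lines"
      using assms ne dist_in_dists line_in_lines by blast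
  qed (use finite_dists finite_lines in auto)
  then show ?thesis by (simp add: card_cartesian_product)
qed

section \<open>The sphere around \<open>v\<close> and its classes\<close>

definition S :: "'a set" where "S = {z \<in> V. \<rho> v z = r}"
definition cls :: "'a \<Rightarrow> 'a set" where "cls y = {z \<in> S. line v z = line v y}"

lemma S_D: "y \<in> S \<Longrightarrow> y \<in> V" "y \<in> S \<Longrightarrow> \<rho> v y = r" "y \<in> S \<Longrightarrow> v \<noteq> y"
  using r_pos v_in_V zero[of v v] by (auto simp: S_def)

lemma finite_S: "finite S" using finite_V by (simp add: S_def)

lemma dist_S_le: "y \<in> S \<Longrightarrow> z \<in> S \<Longrightarrow> \<rho> y z \<le> 2 * r"
  using triangle[of y v z] S_D v_in_V commute[of y v] by force

lemma cls_dist: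
  assumes "y \<in> S" "z \<in> cls y" "z \<noteq> y"
  shows "\<rho> y z = 2 * r" "\<rho> z y = 2 * r"
  using antipodal_if_same_line[of v y z] assms S_D v_in_V commute[of z y]
  by (auto simp: cls_def)

lemma antipodal_iff_mem_line:
  assumes "y \<in> S" "z \<in> S" "y \<noteq> z"
  shows "z \<in> line v y \<longleftrightarrow> \<rho> z y = 2 * r"
  using mem_line_iff[of v y z] assms S_D v_in_V dist_pos[of z y] commute[of z v] by auto

text \<open>By \<open>antipodal_iff_mem_line\<close>, being antipodal to \<open>y\<close> depends
  only on \<open>line v y\<close>, hence only on the class of \<open>y\<close>.\<close>

lemma antipodal_cong:
  assumes "y \<in> S" "y' \<in> cls y" "z \<in> S" "z \<noteq> y" "z \<noteq> y'"
  shows "\<rho> z y' = 2 * r \<longleftrightarrow> \<rho> z y = 2 * r"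
  using antipodal_iff_mem_line[of y z] antipodal_iff_mem_line[of y' z] assms
  by (auto simp: cls_def)

text \<open>If \<open>a\<close> is in the middle, its two distances sum to less than
  \<open>2 * r\<close>. Otherwise the longest distance is at most \<open>2 * r\<close> and \<rho> c
  t already takes more than \<open>r\<close> of it.\<close>

lemma near_if_mem_medium_line:
  assumes "c \<in> S" "t \<in> S" "a \<in> S" "a \<noteq> c" "a \<noteq> t" "c \<noteq> t" "\<rho> c t < 2 * r" "r < \<rho> c t"
    and "a \<in> line c t"
  shows "\<rho> a c < r \<or> \<rho> a t < r"
  using mem_line_iff[of c t a] assms S_D dist_S_le[of a c] dist_S_le[of a t] by force

section \<open>Near points and medium pairs\<close>

text \<open>The threshold 3 leaves every point at least two class mates, as
  \<open>card_medium_ge\<close> requires.\<close>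

definition Y0 :: "'a set" where "Y0 = {y \<in> S. 3 \<le> card (cls y)}"
definition near :: "'a \<Rightarrow> 'a set" where "near c = {a \<in> Y0. a \<noteq> c \<and> \<rho> a c < r}"
definition medium :: "('a \<times> 'a) set" where
  "medium = {(c, t). c \<in> Y0 \<and> t \<in> Y0 \<and> r < \<rho> c t \<and> \<rho> c t < 2 * r}"
definition Y1 :: "'a set" where "Y1 = {c \<in> Y0. near c = {}}"

lemma Y0_S: "y \<in> Y0 \<Longrightarrow> y \<in> S" by (simp add: Y0_def)
lemma finite_Y0: "finite Y0" using finite_S by (simp add: Y0_def)

lemma card_S_le: "card S \<le> card Y0 + 2 * card lines"
proof -
  have "card (S - Y0) \<le> 2 * card lines"
  proof (rule card_le_mult_image_fibres)
    show "line v ` (S - Y0) \<subseteq> lines"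
      using S_D v_in_V line_in_lines by blast
    fix b
    show "card {a \<in> S - Y0. line v a = b} \<le> 2"
    proof (cases "{a \<in> S - Y0. line v a = b} = {}")
      case False
      then obtain y where y: "y \<in> S - Y0" "line v y = b" by blast
      have "card {a \<in> S - Y0. line v a = b} \<le> card (cls y)"
        using y finite_S by (intro card_mono) (auto simp: cls_def)
      then show ?thesis using y by (auto simp: Y0_def)
    next
      case True
      then show ?thesis by (metis card.empty zero_le)
    qed
  qed (use finite_S finite_lines in auto)
  moreover have "S = Y0 \<union> (S - Y0)" by (auto simp: Y0_def)
  ultimately show ?thesis
    using card_Un_le[of Y0 "S - Y0"] by simp
qed

lemma cls_sym: "a \<in> cls b \<Longrightarrow> b \<in> S \<Longrightarrow> cls a = cls b"
  by (auto simp: cls_def)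

lemma self_cls: "a \<in> S \<Longrightarrow> a \<in> cls a" by (simp add: cls_def)

lemma cls_Y0: "y \<in> Y0 \<Longrightarrow> z \<in> cls y \<Longrightarrow> z \<in> Y0"
  using cls_sym[of z y] by (auto simp: Y0_def cls_def)

text \<open>The triangle inequality through \<open>a\<close> gives more than \<open>r\<close>. The
  value \<open>2 * r\<close> is excluded because \<open>antipodal_cong\<close> would transfer it to
  the short distance between \<open>c\<close> and \<open>a\<close>.\<close>

lemma medium_if_near:
  assumes "c \<in> Y0" "a \<in> near c" "a' \<in> cls a" "a' \<noteq> a"
  shows "(c, a') \<in> medium"
proof -
  have a: "a \<in> Y0" "a \<noteq> c" "\<rho> a c < r" using assms by (auto simp: near_def)
  have S: "a \<in> S" "a' \<in> S" "c \<in> S" and Y: "a' \<in> Y0"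
    using a assms Y0_S cls_Y0 by auto
  have d: "\<rho> a a' = 2 * r" using cls_dist assms S by simp
  have ca: "\<rho> c a = \<rho> a c" by (rule commute)
  have ne: "c \<noteq> a'" using d a r_pos by force
  have "\<rho> a a' \<le> \<rho> a c + \<rho> c a'" using triangle S S_D by blast
  then have "r < \<rho> c a'" using d a by simp
  moreover have "\<rho> c a' \<noteq> 2 * r"
    using antipodal_cong[OF S(1) assms(3) S(3)] a ne ca r_pos by auto
  ultimately show ?thesis
    using dist_S_le[OF S(3,2)] assms(1) Y by (simp add: medium_def)
qed

text \<open>Each near point contributes its class mates. No mate is counted twice: two near points
  of one class would be \<open>2 * r\<close> apart, although both are closer than \<open>r\<close>
  to \<open>c\<close>.\<close>

lemma card_medium_ge:
  assumes "c \<in> Y0"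
  shows "2 * card (near c) \<le> card {t. (c, t) \<in> medium}"
proof -
  have finn: "finite (near c)" using finite_Y0 by (simp add: near_def)
  have fincls: "finite (cls a)" for a using finite_S by (simp add: cls_def)
  have two: "2 \<le> card (cls a - {a})" if "a \<in> near c" for a
    using that fincls[of a] self_cls[of a] by (auto simp: near_def Y0_def)
  have disj: "(cls a - {a}) \<inter> (cls b - {b}) = {}" if ab: "a \<in> near c" "b \<in> near c" "a \<noteq> b" for a b
  proof (rule ccontr)
    assume "\<not> ?thesis"
    then have "b \<in> cls a" using ab by (auto simp: cls_def near_def Y0_def)
    then have "\<rho> a b = 2 * r" using ab cls_dist[of a b] by (auto simp: near_def Y0_def)
    moreover have "\<rho> a b \<le> \<rho> a c + \<rho> c b"
      using ab assms triangle S_D Y0_S by (auto simp: near_def)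
    ultimately show False using ab commute[of c b] by (auto simp: near_def)
  qed
  have "2 * card (near c) = (\<Sum>a\<in>near c. 2)" by simp
  also have "\<dots> \<le> (\<Sum>a\<in>near c. card (cls a - {a}))" using two by (intro sum_mono)
  also have "\<dots> = card (\<Union>a\<in>near c. cls a - {a})"
    using finn fincls disj by (intro card_UN_disjoint[symmetric]) auto
  also have "\<dots> \<le> card {t. (c, t) \<in> medium}"
  proof (rule card_mono)
    show "finite {t. (c, t) \<in> medium}"
      by (rule finite_subset[OF _ finite_Y0]) (auto simp: medium_def)
    show "(\<Union>a\<in>near c. cls a - {a}) \<subseteq> {t. (c, t) \<in> medium}"
      using medium_if_near[OF assms] by auto
  qed
  finally show ?thesis .
qed

lemma finite_medium: "finite medium"
  by (rule finite_subset[of _ "Y0 \<times> Y0"]) (use finite_Y0 in \<open>auto simp: medium_def\<close>)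

lemma medium_D:
  assumes "(c, t) \<in> medium"
  shows "c \<in> Y0" "t \<in> Y0" "c \<in> S" "t \<in> S" "c \<in> V" "t \<in> V" "c \<noteq> t" "r < \<rho> c t" "\<rho> c t < 2 * r"
  using assms r_pos zero[of c c] Y0_S S_D by (auto simp: medium_def)

lemma medium_sym: "(c, t) \<in> medium \<longleftrightarrow> (t, c) \<in> medium"
  by (auto simp: medium_def commute)

text \<open>All these lines contain \<open>c\<close>, so by \<open>near_if_mem_medium_line\<close>
  each pair has an endpoint in \<open>insert c (near c)\<close>. By \<open>companion_unique\<close>,
  each point is the first, and likewise the second, coordinate of at most one pair.\<close>

lemma card_medium_fibre_le:
  assumes "(c, t) \<in> medium"
  shows "card {(c', t') \<in> medium. line c' t' = line c t \<and> \<rho> c' t' = \<rho> c t}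
    \<le> 2 * (1 + card (near c))"
proof -
  let ?O = "{(c', t') \<in> medium. line c' t' = line c t \<and> \<rho> c' t' = \<rho> c t}"
  let ?N = "insert c (near c)"
  have finn: "finite ?N" using finite_Y0 by (simp add: near_def)
  have finO: "finite ?O" by (rule finite_subset[OF _ finite_medium]) auto
  have cov: "c' \<in> ?N \<or> t' \<in> ?N" if "(c', t') \<in> ?O" for c' t'
  proof (rule ccontr)
    assume n: "\<not> ?thesis"
    have m: "(c', t') \<in> medium" "c \<in> line c' t'" using that ends_in_line by auto
    then have "\<rho> c c' < r \<or> \<rho> c t' < r"
      using near_if_mem_medium_line[of c' t' c] medium_D[OF m(1)] medium_D[OF assms] n by auto
    then show False using n medium_D[OF m(1)] commute[of c] by (auto simp: near_def)
  qed
  have eq: "b = b'" if "(a, b) \<in> ?O" "(a, b') \<in> ?O" for a b b'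
    using that companion_unique[of a b b'] medium_D[of a b] medium_D[of a b'] by auto
  have swap: "(b, a) \<in> ?O" if "(a, b) \<in> ?O" for a b
    using that medium_sym[of a b] line_sym[of a b] commute[of a b] by auto
  have A: "card {p \<in> ?O. fst p \<in> ?N} \<le> card ?N"
  proof (rule card_inj_on_le[OF _ _ finn])
    show "inj_on fst {p \<in> ?O. fst p \<in> ?N}"
    proof (rule inj_onI)
      fix p q
      assume "p \<in> {p \<in> ?O. fst p \<in> ?N}" "q \<in> {p \<in> ?O. fst p \<in> ?N}" "fst p = fst q"
      then show "p = q" using eq[of "fst p" "snd p" "snd q"] by (auto simp: prod_eq_iff)
    qed
  qed auto
  have B: "card {p \<in> ?O. snd p \<in> ?N} \<le> card ?N"
  proof (rule card_inj_on_le[OF _ _ finn])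
    show "inj_on snd {p \<in> ?O. snd p \<in> ?N}"
    proof (rule inj_onI)
      fix p q
      assume "p \<in> {p \<in> ?O. snd p \<in> ?N}" "q \<in> {p \<in> ?O. snd p \<in> ?N}" "snd p = snd q"
      then show "p = q"
        using eq[of "snd p" "fst p" "fst q"] swap[of "fst p" "snd p"] swap[of "fst q" "snd q"]
        by (auto simp: prod_eq_iff)
    qed
  qed auto
  have "?O = {p \<in> ?O. fst p \<in> ?N} \<union> {p \<in> ?O. snd p \<in> ?N}"
    using cov by fastforce
  then have "card ?O \<le> card {p \<in> ?O. fst p \<in> ?N} + card {p \<in> ?O. snd p \<in> ?N}"
    by (metis (no_types, lifting) card_Un_le)
  also have "\<dots> \<le> card ?N + card ?N" by (rule add_mono[OF A B])
  also have "\<dots> = 2 * (1 + card (near c))"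
    using finn by (simp add: near_def)
  finally show ?thesis .
qed

text \<open>Every ordered medium pair \<open>(c, t)\<close> gets weight \<open>1 / (1 + card (near c))\<close>; the pairs sharing
  line and distance have total weight at most 2, while the pairs starting at a point \<open>c\<close> with
  \<open>near c \<noteq> {}\<close> have total weight at least 1.\<close>

lemma card_not_isolated_le:
  "card {c \<in> Y0. near c \<noteq> {}} \<le> 2 * (card {d \<in> dists. r < d \<and> d < 2 * r} * card lines)"
proof -
  define key where "key = (\<lambda>(c, t). (\<rho> c t, line c t))"
  define h :: "'a \<times> 'a \<Rightarrow> real" where "h = (\<lambda>(c, t). 1 / (1 + real (card (near c))))"
  let ?K = "{d \<in> dists. r < d \<and> d < 2 * r} \<times> lines"
  have fib: "sum h {p \<in> medium. key p = k} \<le> 2" for k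
  proof (cases "{p \<in> medium. key p = k} = {}")
    case False
    let ?F = "{p \<in> medium. key p = k}"
    have finF: "finite ?F" using finite_medium by simp
    have pos: "0 < real (card ?F)" using False finF by (simp add: card_gt_0_iff)
    \<comment> \<open>Any member of the fibre can serve as the base pair in
      \<open>card_medium_fibre_le\<close>.\<close>
    have "h p \<le> 2 / real (card ?F)" if p: "p \<in> ?F" for p
    proof -
      obtain c t where ct: "p = (c, t)" by fastforce
      have "?F = {(c', t') \<in> medium. line c' t' = line c t \<and> \<rho> c' t' = \<rho> c t}"
        using p ct by (auto simp: key_def)
      then have "card ?F \<le> 2 * (1 + card (near c))"
        using card_medium_fibre_le[of c t] p ct by simp
      then have "real (card ?F) \<le> 2 * (1 + real (card (near c)))"
        by (metis (no_types, lifting) of_nat_1 of_nat_add of_nat_le_iff of_nat_mult of_nat_numeral)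
      then show ?thesis using pos ct by (simp add: h_def field_simps)
    qed
    then have "sum h ?F \<le> real (card ?F) * (2 / real (card ?F))"
      by (rule sum_bounded_above)
    then show ?thesis using pos by simp
  next
    case True
    then show ?thesis by (simp only: sum.empty)
  qed
  have keys: "key ` medium \<subseteq> ?K"
    using medium_D dist_in_dists line_in_lines by (fastforce simp: key_def)
  have finK: "finite ?K" using finite_dists finite_lines by simp
  have "sum h medium = (\<Sum>k\<in>key ` medium. sum h {p \<in> medium. key p = k})"
    by (rule sum.image_gen[OF finite_medium])
  also have "\<dots> \<le> (\<Sum>k\<in>key ` medium. 2)" by (intro sum_mono fib)
  also have "\<dots> = 2 * real (card (key ` medium))" by simp
  also have "\<dots> \<le> 2 * real (card ?K)"
    using card_mono[OF finK keys] by simp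
  finally have upper: "sum h medium \<le> 2 * real (card ?K)" .
  let ?I = "{c \<in> Y0. near c \<noteq> {}}"
  define e where "e = (\<lambda>c. {t. (c, t) \<in> medium})"
  have fine: "finite (e c)" for c
    by (rule finite_subset[OF _ finite_Y0]) (auto simp: e_def medium_def)
  \<comment> \<open>With k \<ge> 1 near points there are at least 2k \<ge> k + 1 pairs, each of
    weight 1/(1 + k).\<close>
  have one: "1 \<le> (\<Sum>t\<in>e c. h (c, t))" if c: "c \<in> ?I" for c
  proof -
    have "1 \<le> card (near c)"
      using c finite_Y0 by (auto simp: near_def Suc_le_eq card_gt_0_iff)
    moreover have "2 * card (near c) \<le> card (e c)"
      using card_medium_ge c by (simp add: e_def)
    ultimately have "1 + card (near c) \<le> card (e c)" by linarith
    then have "1 + real (card (near c)) \<le> real (card (e c))"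
      by (metis of_nat_1 of_nat_add of_nat_le_iff)
    then show ?thesis by (simp add: h_def field_simps)
  qed
  have "real (card ?I) = (\<Sum>c\<in>?I. 1)" by simp
  also have "\<dots> \<le> (\<Sum>c\<in>?I. \<Sum>t\<in>e c. h (c, t))" by (intro sum_mono one)
  also have "\<dots> \<le> (\<Sum>c\<in>Y0. \<Sum>t\<in>e c. h (c, t))"
    using finite_Y0 by (intro sum_mono2 sum_nonneg) (auto simp: h_def)
  also have "\<dots> = (\<Sum>(c, t)\<in>Sigma Y0 e. h (c, t))"
    using finite_Y0 fine by (intro sum.Sigma) auto
  also have "\<dots> = sum h medium"
    by (rule sum.cong) (auto simp: e_def medium_def)
  finally have "real (card ?I) \<le> 2 * real (card ?K)" using upper by linarith
  then show ?thesis by (simp add: card_cartesian_product flip: of_nat_mult)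
qed

section \<open>Points without near points\<close>

definition medium1 :: "('a \<times> 'a) set" where "medium1 = medium \<inter> Y1 \<times> Y1"

lemma Y1_D: "y \<in> Y1 \<Longrightarrow> y \<in> Y0" "y \<in> Y1 \<Longrightarrow> y \<in> S" "y \<in> Y1 \<Longrightarrow> y \<in> V"
  using Y0_S S_D by (auto simp: Y1_def)

lemma dist_Y1_ge: "a \<in> Y1 \<Longrightarrow> b \<in> Y1 \<Longrightarrow> a \<noteq> b \<Longrightarrow> r \<le> \<rho> a b"
  by (force simp: Y1_def near_def)

lemma finite_Y1: "finite Y1"
  using finite_Y0 by (simp add: Y1_def)

text \<open>Distances inside \<open>Y1\<close> are at least \<open>r\<close>, so by
  \<open>near_if_mem_medium_line\<close> the line of a medium pair meets \<open>Y1\<close> only in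
  its two endpoints. The factor 2 counts the two orders.\<close>

lemma card_medium1_le: "card medium1 \<le> 2 * card lines"
proof (rule card_le_mult_image_fibres)
  show "finite medium1" using finite_medium by (simp add: medium1_def)
  show "(\<lambda>(c, t). line c t) ` medium1 \<subseteq> lines"
    using medium_D(5-7) line_in_lines by (auto simp: medium1_def)
  fix b
  let ?F = "{p \<in> medium1. (\<lambda>(c, t). line c t) p = b}"
  show "card ?F \<le> 2"
  proof (cases "?F = {}")
    case False
    then obtain c t where ct: "(c, t) \<in> medium1" "line c t = b" by auto
    have m: "(c, t) \<in> medium" "c \<in> Y1" "t \<in> Y1" using ct by (auto simp: medium1_def)
    have on: "a = c \<or> a = t" if a: "a \<in> Y1" "a \<in> b" for a
    proof (rule ccontr)
      assume n: "\<not> ?thesis"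
      then have "\<rho> a c < r \<or> \<rho> a t < r"
        using near_if_mem_medium_line[of c t a] medium_D[OF m(1)] a ct(2) Y1_D(2) by blast
      then show False using dist_Y1_ge[OF a(1) m(2)] dist_Y1_ge[OF a(1) m(3)] n by auto
    qed
    have "?F \<subseteq> {(c, t), (t, c)}"
    proof
      fix p assume "p \<in> ?F"
      then obtain c' t' where p: "p = (c', t')" "(c', t') \<in> medium1" "line c' t' = b" by auto
      then have "c' \<in> Y1" "t' \<in> Y1" "(c', t') \<in> medium" by (auto simp: medium1_def)
      moreover from this have "c' \<noteq> t'" using medium_D(7) by blast
      moreover have "c' \<in> b" "t' \<in> b" using p(3) ends_in_line by blast+
      ultimately show "p \<in> {(c, t), (t, c)}" using on p(1) by blast
    qed
    then have "card ?F \<le> card {(c, t), (t, c)}" by (rule card_mono[rotated]) simp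
    moreover have "card {(c, t), (t, c)} \<le> 2" by (rule card_insert_le_m1) simp_all
    ultimately show ?thesis by (rule order_trans)
  next
    case True
    then show ?thesis by (simp only: card.empty)
  qed
qed (rule finite_lines)

text \<open>When two disjoint twin pairs generate one line, a third twin \<open>u\<close> of the first pair lies
  off that line, so it cannot be at distance \<open>r\<close> from both points of the second pair.\<close>

lemma medium_if_same_line:
  assumes "y \<in> Y1" "y' \<in> Y1" "s \<in> Y1" "s' \<in> Y1" "u \<in> Y1"
    and "y' \<in> cls y" "u \<in> cls y" "s' \<in> cls s"
    and "y \<noteq> y'" "u \<noteq> y" "u \<noteq> y'" "s \<noteq> s'" "y \<noteq> s" "y \<noteq> s'" "y' \<noteq> s" "y' \<noteq> s'"
    and "line y y' = line s s'"
  shows "(u, s) \<in> medium1 \<or> (u, s') \<in> medium1"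
proof -
  note S = assms(1-5)[THEN Y1_D(2)]
  note V = assms(1-5)[THEN Y1_D(3)]
  have dd: "\<rho> y y' = 2 * r" "\<rho> s s' = 2 * r" "\<rho> u y = 2 * r"
    using cls_dist[of y y'] cls_dist[of s s'] cls_dist[of y u] assms S by auto
  have "u \<in> cls y'" using assms(6,7) by (auto simp: cls_def)
  then have du: "\<rho> u y' = 2 * r" using cls_dist[of y' u] assms S by auto
  have "y \<in> line s s'" using assms(17) ends_in_line by auto
  \<comment> \<open>As distances in \<open>Y1\<close> are at least \<open>r\<close>, an endpoint
    position of \<open>y\<close> would create a distance of at least \<open>3 * r\<close>. So
    \<open>y\<close> is in the middle.\<close>
  then have y: "\<rho> y s = r" "\<rho> y s' = r"
    using mem_line_iff[of s s' y] V assms dd dist_Y1_ge[of y s] dist_Y1_ge[of y s']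
      dist_S_le[OF S(1) S(3)] dist_S_le[OF S(1) S(4)] r_pos by auto
  have sy: "\<rho> s y = r" "\<rho> s' y = r" using y by (simp_all add: commute)
  have us: "u \<noteq> s" "u \<noteq> s'" using dd du sy r_pos by auto
  have "u \<notin> line y y'" using mem_line_iff[of y y' u] V assms dd du r_pos by auto
  then have "u \<notin> line s s'" using assms(17) by simp
  then have "\<rho> u s \<noteq> r \<or> \<rho> u s' \<noteq> r" using mem_line_iff[of s s' u] V us assms dd by auto
  moreover have "(u, t) \<in> medium1" if t: "t \<in> {s, s'}" "\<rho> u t \<noteq> r" for t
  proof -
    have T: "t \<in> Y1" "t \<in> S" "u \<noteq> t" "t \<noteq> y" "\<rho> t y = r" using t us assms S sy by auto
    have "\<rho> u t \<noteq> 2 * r"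
      using antipodal_cong[of y u t] T S assms(7) r_pos commute[of t u] by auto
    then show ?thesis
      using t T S assms(5) dist_Y1_ge[of u t] dist_S_le[of u t] Y1_D
      by (simp add: medium1_def medium_def)
  qed
  ultimately show ?thesis by blast
qed

text \<open>With m lines, the pairing gives |Y1| \<le> 2|D| + 2m, the coincidences give 2|D| \<le>
  2m + |C|, and |C| \<le> 2m because \<open>C\<close> injects into \<open>medium1\<close>.\<close>

lemma card_Y1_le: "card Y1 \<le> 6 * card lines"
proof -
  from ex_disjoint_pairs_in_fibres[OF finite_Y1, of "line v"]
  obtain D g u where D: "D \<subseteq> Y1" "g ` D \<subseteq> Y1" "inj_on g D" "D \<inter> g ` D = {}"
    and tw: "\<And>y. y \<in> D \<Longrightarrow> line v (g y) = line v y \<and> u y \<in> Y1 \<and> line v (u y) = line v y \<and>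
      u y \<noteq> y \<and> u y \<noteq> g y"
    and cY: "card Y1 \<le> 2 * card D + 2 * card (line v ` Y1)" by metis
  have finD: "finite D" using D(1) finite_Y1 finite_subset by blast
  have "line v ` Y1 \<subseteq> lines" using Y1_D S_D v_in_V line_in_lines by blast
  then have cl: "card (line v ` Y1) \<le> card lines" by (rule card_mono[OF finite_lines])
  define h where "h = (\<lambda>y. line y (g y))"
  let ?C = "{(y, s). y \<in> D \<and> s \<in> D \<and> y \<noteq> s \<and> h y = h s}"
  have basic: "y \<in> Y1" "g y \<in> Y1" "u y \<in> Y1" "g y \<in> cls y" "u y \<in> cls y" "y \<noteq> g y"
    "u y \<noteq> y" "u y \<noteq> g y" if "y \<in> D" for y
    using that D tw[OF that] Y1_D by (auto simp: cls_def)
  have ne: "y \<noteq> g s" "g y \<noteq> s" "y \<noteq> s \<Longrightarrow> g y \<noteq> g s" if "y \<in> D" "s \<in> D" for y s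
    using that D by (auto dest: inj_onD)
  have hD: "h ` D \<subseteq> lines"
    using basic Y1_D line_in_lines by (auto simp: h_def)
  \<comment> \<open>Two different pairs of one class consist of four points at mutual distance
    \<open>2 * r\<close>, so neither line contains the other pair.\<close>
  have same: "y = s" if ys: "y \<in> D" "s \<in> D" "h y = h s" "s \<in> cls y" for y s
  proof (rule ccontr)
    assume n: "y \<noteq> s"
    have Vs: "y \<in> V" "g y \<in> V" "s \<in> V" and Ss: "y \<in> S" "g y \<in> S"
      using ys basic Y1_D by blast+
    have "s \<in> cls (g y)" using ys basic[of y] by (auto simp: cls_def)
    then have "\<rho> y (g y) = 2 * r" "\<rho> s y = 2 * r" "\<rho> s (g y) = 2 * r"
      using cls_dist ys basic[OF ys(1)] Ss n ne[OF ys(1,2)] by metis+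
    then have "s \<notin> line y (g y)"
      using mem_line_iff[of y "g y" s] Vs n ne[OF ys(1,2)] basic[OF ys(1)] r_pos by auto
    then show False using ys(3) ends_in_line[of s] by (auto simp: h_def)
  qed
  define t where "t = (\<lambda>y s. if (u y, s) \<in> medium1 then s else g s)"
  have t: "t y s \<in> {s, g s}" "(u y, t y s) \<in> medium1"
    if ys: "y \<in> D" "s \<in> D" "y \<noteq> s" "h y = h s" for y s
  proof -
    have "line y (g y) = line s (g s)" using ys(4) by (simp add: h_def)
    then have "(u y, s) \<in> medium1 \<or> (u y, g s) \<in> medium1"
      using medium_if_same_line[of y "g y" s "g s" "u y"] basic[OF ys(1)] basic[OF ys(2)]
        ne[OF ys(1,2)] ys(3) by blast
    then show "t y s \<in> {s, g s}" "(u y, t y s) \<in> medium1" by (auto simp: t_def)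
  qed
  have "card ?C \<le> card medium1"
  proof (rule card_inj_on_le)
    \<comment> \<open>Disjointness of the pairs recovers \<open>s\<close> from \<open>t y s\<close>;
      the class of \<open>u y\<close> together with the line \<open>h s\<close> then recovers
      \<open>y\<close>.\<close>
    have inj: "y = z \<and> s = x" if m: "y \<in> D" "s \<in> D" "z \<in> D" "x \<in> D" "y \<noteq> s" "z \<noteq> x"
      "h y = h s" "h z = h x" "u y = u z" "t y s = t z x" for y s z x
    proof -
      have "t y s \<in> {s, g s}" "t y s \<in> {x, g x}"
        using t(1)[of y s] t(1)[of z x] m by simp_all
      then have sx: "s = x" using ne[OF m(2,4)] by (metis insertE singletonD)
      have "line v z = line v y" using tw[OF m(1)] tw[OF m(3)] m(9) by simp
      then have "z \<in> cls y" using basic(1)[OF m(3)] Y1_D(2) by (simp add: cls_def)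
      then show ?thesis using same[OF m(1,3)] m(7,8) sx by simp
    qed
    show "inj_on (\<lambda>(y, s). (u y, t y s)) ?C"
    proof (intro inj_onI)
      fix p q
      assume "p \<in> ?C" "q \<in> ?C" "(\<lambda>(y, s). (u y, t y s)) p = (\<lambda>(y, s). (u y, t y s)) q"
      then show "p = q" using inj[of "fst p" "snd p" "fst q" "snd q"]
        by (simp add: case_prod_beta prod_eq_iff)
    qed
    show "(\<lambda>(y, s). (u y, t y s)) ` ?C \<subseteq> medium1" using t(2) by auto
    show "finite medium1" using finite_medium by (simp add: medium1_def)
  qed
  then show ?thesis
    using card_coincidences_ge[OF finD hD finite_lines] card_medium1_le cY cl by linarith
qed

section \<open>Adding up the bounds\<close>

text \<open>Points inside the sphere are farther than \<open>r\<close> from \<open>v'\<close>, so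
  \<open>card_far_le\<close> at \<open>v'\<close> bounds them, just as at \<open>v\<close> it bounds
  the points outside.\<close>

lemma card_V_le_sphere:
  assumes "v' \<in> V" "\<rho> v v' = 2 * r"
  shows "card V \<le> card S + 2 * (card {d \<in> dists. r < d} * card lines)"
proof -
  have "{t \<in> V. \<rho> v t < r} \<subseteq> {t \<in> V. r < \<rho> v' t}"
    using triangle[of v _ v'] assms v_in_V commute[of v'] by force
  then have "card {t \<in> V. \<rho> v t < r} \<le> card {t \<in> V. r < \<rho> v' t}"
    using finite_V by (intro card_mono) auto
  then have a: "card {t \<in> V. \<rho> v t < r} \<le> card {d \<in> dists. r < d} * card lines"
    using card_far_le[OF assms(1)] by linarith
  have "V = S \<union> ({t \<in> V. r < \<rho> v t} \<union> {t \<in> V. \<rho> v t < r})" by (auto simp: S_def)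
  then have "card V \<le> card S + (card {t \<in> V. r < \<rho> v t} + card {t \<in> V. \<rho> v t < r})"
    by (metis (no_types, lifting) add_left_mono card_Un_le order_trans)
  then show ?thesis using a card_far_le[OF v_in_V] by linarith
qed

lemma card_V_le:
  assumes "v' \<in> V" "\<rho> v v' = 2 * r" "r \<in> dists"
  shows "card V \<le> 5 * card dists * card lines"
proof -
  let ?w1 = "card {d \<in> dists. r < d}" and ?w2 = "card {d \<in> dists. r < d \<and> d < 2 * r}"
  have "v \<noteq> v'" using assms r_pos v_in_V by auto
  then have d2: "2 * r \<in> dists" using dist_in_dists[of v v'] assms v_in_V by simp
  have "card (insert r {d \<in> dists. r < d}) \<le> card dists"
    using assms finite_dists by (intro card_mono) auto
  then have w1: "?w1 + 1 \<le> card dists" using finite_dists by simp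
  have "card (insert r (insert (2 * r) {d \<in> dists. r < d \<and> d < 2 * r})) \<le> card dists"
    using assms d2 finite_dists by (intro card_mono) auto
  then have w2: "?w2 + 2 \<le> card dists" using finite_dists r_pos by simp
  have "Y0 = Y1 \<union> {c \<in> Y0. near c \<noteq> {}}" by (auto simp: Y1_def)
  then have "card Y0 \<le> card Y1 + card {c \<in> Y0. near c \<noteq> {}}" by (metis (no_types, lifting) card_Un_le)
  \<comment> \<open>The 8 is 6 from \<open>card_Y1_le\<close> plus 2 from
    \<open>card_S_le\<close>.\<close>
  then have "card V \<le> (2 * ?w1 + 2 * ?w2 + 8) * card lines"
    using card_V_le_sphere[OF assms(1,2)] card_S_le card_not_isolated_le card_Y1_le
    by (simp add: algebra_simps)
  also have "\<dots> \<le> (5 * card dists) * card lines"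
    using w1 w2 by (intro mult_right_mono) auto
  finally show ?thesis .
qed

end

section \<open>Choice of the radius and conclusion\<close>

context finite_metric
begin

theorem card_le_dists_lines:
  assumes "2 \<le> card V"
  shows "card V \<le> 5 * card dists * card lines"
proof -
  define R where "R = {\<rho> x y | x y z. x \<in> V \<and> y \<in> V \<and> z \<in> V \<and> x \<noteq> y \<and> x \<noteq> z \<and> y \<noteq> z \<and>
    \<rho> x y = \<rho> x z \<and> line x y = line x z}"
  have RI: "\<rho> x y \<in> R" if "x \<in> V" "y \<in> V" "z \<in> V" "x \<noteq> y" "x \<noteq> z" "y \<noteq> z"
    "\<rho> x y = \<rho> x z" "line x y = line x z" for x y z
    using that unfolding R_def by blast
  show ?thesis
  proof (cases "R = {}")
    \<comment> \<open>Without a coincidence, distance and line from a single base point identify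
      every other point.\<close>
    case True
    obtain x where x: "x \<in> V" using assms by fastforce
    have "card (V - {x}) \<le> card (dists \<times> lines)"
    proof (rule card_inj_on_le)
      show "inj_on (\<lambda>y. (\<rho> x y, line x y)) (V - {x})"
        using RI True x by (auto simp: inj_on_def)
      show "(\<lambda>y. (\<rho> x y, line x y)) ` (V - {x}) \<subseteq> dists \<times> lines"
        using x dist_in_dists line_in_lines by auto
    qed (use finite_dists finite_lines in auto)
    then have "card V \<le> card dists * card lines + 1"
      using x finite_V by (simp add: card_cartesian_product card_Diff_singleton)
    moreover from this have "1 \<le> card dists * card lines" using assms by linarith
    ultimately show ?thesis by linarith
  next
    case False
    have Rd: "R \<subseteq> dists" unfolding R_def using dist_in_dists by blast
    then have finR: "finite R" using finite_dists finite_subset by blast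
    define r where "r = Max R"
    have "r \<in> R" using Max_in finR False r_def by simp
    then obtain x v v' where xv: "x \<in> V" "v \<in> V" "v' \<in> V" "x \<noteq> v" "x \<noteq> v'" "v \<noteq> v'"
      "\<rho> x v = \<rho> x v'" "line x v = line x v'" "r = \<rho> x v" unfolding R_def by blast
    interpret extremal_radius V \<rho> r v
    proof
      show "v \<in> V" "0 < r" using xv dist_pos by auto
      fix a b c
      assume "a \<in> V" "b \<in> V" "c \<in> V" "a \<noteq> b" "a \<noteq> c" "\<rho> a b = \<rho> a c" "r < \<rho> a b"
        "line a b = line a c"
      then show "b = c" using RI[of a b c] Max_ge[OF finR, of "\<rho> a b"] r_def by fastforce
    qed
    show ?thesis
      using card_V_le[of v'] antipodal_if_same_line[of x v v'] xv \<open>r \<in> R\<close> Rd by auto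
  qed
qed

end

theorem mainTheorem4:
  fixes V :: "'a set" and \<rho> :: "'a \<Rightarrow> 'a \<Rightarrow> real" and n :: nat and W :: "real set"
  assumes "Metric_space V \<rho>"
    and "finite V" and "card V = n" and "n \<ge> 2"
    and "W = {\<rho> a b | a b. a \<in> V \<and> b \<in> V \<and> a \<noteq> b}"
  shows "real (card (mlines V \<rho>)) \<ge> real n / (5 * real (card W))"
proof -
  interpret finite_metric V \<rho>
    using assms(1,2) by (simp add: finite_metric_def finite_metric_axioms_def)
  have W: "dists = W" by (simp add: assms(5) dists_def)
  have n: "n \<le> 5 * card W * card (mlines V \<rho>)"
    using card_le_dists_lines assms(3,4) W by simp
  then have "0 < card W" using assms(4) by (cases "card W") auto
  moreover have "real n \<le> 5 * real (card W) * real (card (mlines V \<rho>))"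
    using n by (metis of_nat_le_iff of_nat_mult of_nat_numeral)
  ultimately show ?thesis by (simp add: divide_le_eq mult.commute)
qed

end
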